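(* Let $k\ge 2$ be an integer and let $x>0$ be a real number. Then the number $\pi_k(x)$ of $k$-almost primes less than or equal to $x$ is \[ \pi_k(x)=\sum_{i_{k-1}=1}^{\pi\left(\sqrt[k]{x}\right)}\ \sum_{i_{k-2}=i_{k-1}}^{\pi\left(\sqrt[k-1]{\frac{x}{p_{i_{k-1}}}}\right)}\ \sum_{i_{k-3}=i_{k-2}}^{\pi\left(\sqrt[k-2]{\frac{x}{p_{i_{k-2}}p_{i_{k-1}}}}\right)}\cdots\sum_{i_1=i_2}^{\pi\left(\sqrt{\frac{x}{p_{i_2}p_{i_3}\cdots p_{i_{k-1}}}}\right)}\left(\pi\left(\frac{x}{p_{i_1}p_{i_2}\cdots p_{i_{k-1}}}\right)-i_1+1\right), \] and the number $\pi_k^*(x)$ of square-free $k$-almost primes less than or equal to $x$ is \[ \pi_k^*(x)=\sum_{i_{k-1}=1}^{\pi\left(\sqrt[k]{x}\right)}\ \sum_{i_{k-2}=i_{k-1}+1}^{\pi\left(\sqrt[k-1]{\frac{x}{p_{i_{k-1}}}}\right)}\ \sum_{i_{k-3}=i_{k-2}+1}^{\pi\left(\sqrt[k-2]{\frac{x}{p_{i_{k-2}}p_{i_{k-1}}}}\right)}\cdots\sum_{i_1=i_2+1}^{\pi\left(\sqrt{\frac{x}{p_{i_2}p_{i_3}\cdots p_{i_{k-1}}}}\right)}\left(\pi\left(\frac{x}{p_{i_1}p_{i_2}\cdots p_{i_{k-1}}}\right)-i_1\right). \]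
   Context: For an integer $n>1$ with prime factorization $n=\prod_{i=1}^r q_i^{a_i}$, $\Omega(n)=\sum_{i=1}^r a_i$ is the number of prime factors counted with multiplicity. A $k$-almost prime is an integer $n$ with $\Omega(n)=k$. For real $x$, $\pi(x)$ is the number of primes $\le x$, $\pi_k(x)=\#\{n\le x:\Omega(n)=k\}$, and $\pi_k^*(x)=\#\{n\le x:\Omega(n)=k,\ n\text{ square-free}\}$. $p_i$ denotes the $i$-th prime number ($p_1=2$). The nested sums are over integers $i_{k-1},i_{k-2},\dots,i_1$: the outermost index is $i_{k-1}$, and for $1\le j\le k-2$ the index $i_j$ runs from $i_{j+1}$ (resp. $i_{j+1}+1$ in the square-free formula) to $\pi\left(\left(\frac{x}{p_{i_{j+1}}\cdots p_{i_{k-1}}}\right)^{1/(j+1)}\right)$. For $k=2$ there is a single sum, over $i_1$ from $1$ to $\pi(\sqrt{x})$. A sum whose lower limit exceeds its upper limit is empty and equals $0$. *)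

theory Defs
  imports Complex_Main "HOL-Computational_Algebra.Computational_Algebra" "HOL-Library.Infinite_Set"
begin

definition Omega :: "nat \<Rightarrow> nat" where
  "Omega n = (\<Sum>q\<in>prime_factors n. multiplicity q n)"

definition prime_count :: "real \<Rightarrow> nat" where
  "prime_count x = card {p::nat. prime p \<and> real p \<le> x}"

definition almost_prime_count :: "nat \<Rightarrow> real \<Rightarrow> nat" where
  "almost_prime_count k x = card {n::nat. 1 < n \<and> real n \<le> x \<and> Omega n = k}"

definition sqfree_almost_prime_count :: "nat \<Rightarrow> real \<Rightarrow> nat" where
  "sqfree_almost_prime_count k x =
     card {n::nat. 1 < n \<and> real n \<le> x \<and> Omega n = k \<and> squarefree n}"

text \<open>Primes are numbered from 1, so \<open>nth_prime 1 = 2\<close>; \<open>enumerate\<close> numbers from 0.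
  The value at 0 is irrelevant: no index 0 occurs in the sums below.\<close>

definition nth_prime :: "nat \<Rightarrow> nat" where
  "nth_prime i = enumerate {p::nat. prime p} (i - 1)"

text \<open>The list holds the outer indices already chosen, innermost first: when the sum over
  $i_j$ is evaluated it is $[i_{j+1}, \dots, i_{k-1}]$.\<close>

definition cofactor :: "real \<Rightarrow> nat list \<Rightarrow> real" where
  "cofactor x is = x / (\<Prod>i\<leftarrow>is. real (nth_prime i))"

text \<open>\<open>nested_sum x j is\<close> is the part of the formula beginning at the sum over $i_j$.  At
  \<open>j = 0\<close> it is the summand, where \<open>hd is\<close> is $i_1$; at level \<open>Suc j\<close> the root is the
  $(j+2)$-nd.  The outermost sum has no preceding index and starts at 1.  The summand is an
  integer to avoid truncated subtraction.\<close>

primrec nested_sum :: "real \<Rightarrow> nat \<Rightarrow> nat list \<Rightarrow> int" where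
  "nested_sum x 0 is = int (prime_count (cofactor x is)) - int (hd is) + 1"
| "nested_sum x (Suc j) is =
     (\<Sum>i = (if is = [] then 1 else hd is)..prime_count (root (j + 2) (cofactor x is)).
        nested_sum x j (i # is))"

primrec sqfree_nested_sum :: "real \<Rightarrow> nat \<Rightarrow> nat list \<Rightarrow> int" where
  "sqfree_nested_sum x 0 is = int (prime_count (cofactor x is)) - int (hd is)"
| "sqfree_nested_sum x (Suc j) is =
     (\<Sum>i = (if is = [] then 1 else hd is + 1)..prime_count (root (j + 2) (cofactor x is)).
        sqfree_nested_sum x j (i # is))"

end

(* Every n with Omega n = k + 1 is uniquely p * n', where p is its least prime factor, Omega n' = k,
   and no prime factor of n' is smaller than p (all are larger than p when n is squarefree).
   Since p ^ (k + 1) \<le> n, the index of p among the primes is at most \<pi>(x^(1/(k+1))).  Iterating this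
   on the numbers whose prime factors are bounded from below gives the nested sums. *)

theory Submission
  imports Defs
begin

section \<open>Prime indices\<close>

lemma prime_nth_prime: "prime (nth_prime i)"
  using enumerate_in_set[OF primes_infinite] by (auto simp: nth_prime_def)

lemma nth_prime_pos: "nth_prime i > 0"
  by (rule prime_gt_0_nat[OF prime_nth_prime])

lemma nth_prime_less_iff:
  assumes "1 \<le> i" "1 \<le> j"
  shows "nth_prime i < nth_prime j \<longleftrightarrow> i < j"
  using assms strict_mono_less[OF strict_mono_enumerate[OF primes_infinite], of "i - 1" "j - 1"]
  by (auto simp: nth_prime_def)

lemma nth_prime_le_iff:
  assumes "1 \<le> i" "1 \<le> j"
  shows "nth_prime i \<le> nth_prime j \<longleftrightarrow> i \<le> j"
  using nth_prime_less_iff[OF assms(2,1)] by (auto simp: not_less[symmetric])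

lemma prime_obtain_index:
  assumes "prime p"
  obtains i where "1 \<le> i" "p = nth_prime i"
proof -
  obtain j where "enumerate {p::nat. prime p} j = p"
    using enumerate_Ex[OF primes_infinite, of p] assms by auto
  then show ?thesis
    using that[of "Suc j"] by (simp add: nth_prime_def)
qed

lemma inj_on_nth_prime: "inj_on nth_prime {1..}"
  by (rule linorder_inj_onI') (metis atLeast_iff less_irrefl nth_prime_less_iff)

lemma finite_nat_le_real: "finite {n::nat. P n \<and> real n \<le> y}"
  by (rule finite_subset[of _ "{..nat \<lfloor>y\<rfloor>}"]) (auto simp: le_nat_floor)

text \<open>The primes up to \<open>y\<close> form an initial segment of the enumeration. This turns
  summation limits into inequalities between primes and reals. Index 0 is excluded because
  \<open>nth_prime 0 = nth_prime 1\<close>, so the equivalence would fail there for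
  \<open>y < 2\<close>.\<close>

lemma le_prime_count_iff:
  assumes "1 \<le> i"
  shows "i \<le> prime_count y \<longleftrightarrow> real (nth_prime i) \<le> y"
proof
  assume "real (nth_prime i) \<le> y"
  then have "nth_prime ` {1..i} \<subseteq> {p. prime p \<and> real p \<le> y}"
    using assms by (auto simp: prime_nth_prime nth_prime_le_iff intro: order_trans[rotated])
  then have "card (nth_prime ` {1..i}) \<le> prime_count y"
    unfolding prime_count_def by (intro card_mono finite_nat_le_real)
  then show "i \<le> prime_count y"
    by (subst (asm) card_image) (auto intro: inj_on_subset[OF inj_on_nth_prime])
next
  assume le: "i \<le> prime_count y"
  show "real (nth_prime i) \<le> y"
  proof (rule ccontr)
    assume less: "\<not> real (nth_prime i) \<le> y"
    \<comment> \<open>Every prime up to \<open>y\<close> would have an index below \<open>i\<close>,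
      which leaves at most \<open>i - 1\<close> of them.\<close>
    have "p \<in> nth_prime ` {1..<i}" if p: "prime p" "real p \<le> y" for p
    proof -
      obtain j where j: "1 \<le> j" "p = nth_prime j"
        using prime_obtain_index[OF p(1)] .
      have "nth_prime j < nth_prime i"
        using less p(2) j(2) by simp
      with j assms show ?thesis
        by (simp add: nth_prime_less_iff)
    qed
    then have "{p. prime p \<and> real p \<le> y} \<subseteq> nth_prime ` {1..<i}"
      by blast
    then have "prime_count y \<le> card (nth_prime ` {1..<i})"
      unfolding prime_count_def by (intro card_mono) auto
    also have "\<dots> \<le> i - 1"
      using card_image_le[of "{1..<i}" nth_prime] by simp
    finally show False
      using le assms by simp
  qed
qed

lemma le_prime_count_root_iff:
  assumes "1 \<le> i" "0 < y" "0 < k"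
  shows "i \<le> prime_count (root k y) \<longleftrightarrow> real (nth_prime i) ^ k \<le> y"
proof -
  have "root k (real (nth_prime i) ^ k) = real (nth_prime i)"
    using assms by (simp add: real_root_power_cancel)
  then show ?thesis
    using le_prime_count_iff[OF assms(1)] real_root_le_iff[OF assms(3), of "real (nth_prime i) ^ k" y]
    by simp
qed

section \<open>Factoring out the least prime\<close>

lemma Omega_eq_size: "Omega n = size (prime_factorization n)"
  by (auto simp: Omega_def size_multiset_overloaded_eq count_prime_factorization intro!: sum.cong)

lemma Omega_1 [simp]: "Omega (Suc 0) = 0"
  by (simp add: Omega_eq_size)

lemma Omega_eq_0_iff:
  assumes "n > 0"
  shows "Omega n = 0 \<longleftrightarrow> n = 1"
  using assms by (auto simp: Omega_eq_size prime_factorization_empty_iff)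

lemma Omega_prime_times:
  assumes "prime p" "n > 0"
  shows "Omega (p * n) = Suc (Omega n)"
  using assms by (simp add: Omega_eq_size prime_factorization_mult prime_factorization_prime)

text \<open>\<open>n\<close> is a product of \<open>Omega n\<close> primes, each at least
  \<open>p\<close>; the induction peels off one of them. Applied to the least prime factor, this
  produces the roots in the upper summation limits.\<close>

lemma power_Omega_le:
  assumes "n > 0" "\<And>q. prime q \<Longrightarrow> q dvd n \<Longrightarrow> p \<le> q"
  shows "p ^ Omega n \<le> n"
  using assms
proof (induction "Omega n" arbitrary: n)
  case 0
  then show ?case by simp
next
  case (Suc k)
  then have "n \<noteq> 1" by auto
  then obtain q where q: "prime q" "q dvd n"
    using prime_factor_nat by blast
  then obtain m where m: "n = q * m" by auto
  with Suc.prems have "m > 0" by auto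
  with q m Suc.hyps have k: "k = Omega m" by (simp add: Omega_prime_times)
  have "p ^ Omega m \<le> m"
    using Suc.prems(2) m by (intro Suc.hyps(1) k \<open>m > 0\<close>) auto
  moreover have "p \<le> q" using Suc.prems(2) q by blast
  ultimately show ?case
    using m q \<open>m > 0\<close> by (simp add: Omega_prime_times mult_le_mono)
qed

lemma squarefree_prime_times_iff:
  fixes p n :: nat
  assumes "prime p"
  shows "squarefree (p * n) \<longleftrightarrow> squarefree n \<and> \<not> p dvd n"
proof
  assume *: "squarefree (p * n)"
  have "\<not> p dvd n"
  proof
    assume "p dvd n"
    then have "p ^ 2 dvd p * n" by (simp add: power2_eq_square)
    with * have "is_unit p" by (rule squarefreeD)
    with assms show False by auto
  qed
  with * show "squarefree n \<and> \<not> p dvd n"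
    using squarefree_mono[of n "p * n"] by auto
next
  assume "squarefree n \<and> \<not> p dvd n"
  then show "squarefree (p * n)"
    using assms squarefree_mult_coprime[OF prime_imp_coprime squarefree_prime] by blast
qed

text \<open>One family serves both formulas: \<open>s\<close> switches on squarefreeness and
  \<open>m\<close> is the least admissible prime index. The condition \<open>0 < n\<close> admits
  \<open>n = 1\<close>, which starts the recursion at \<open>k = 0\<close>.\<close>

definition rough_almost_primes :: "bool \<Rightarrow> nat \<Rightarrow> nat \<Rightarrow> real \<Rightarrow> nat set" where
  "rough_almost_primes s k m y = {n. 0 < n \<and> real n \<le> y \<and> Omega n = k
     \<and> (\<forall>q. prime q \<and> q dvd n \<longrightarrow> nth_prime m \<le> q) \<and> (s \<longrightarrow> squarefree n)}"

lemma finite_rough_almost_primes: "finite (rough_almost_primes s k m y)"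
  by (rule finite_subset[OF _ finite_nat_le_real[of "\<lambda>_. True" y]])
     (auto simp: rough_almost_primes_def)

lemma rough_almost_primes_0:
  assumes "1 \<le> y"
  shows "rough_almost_primes s 0 m y = {1}"
  using assms by (auto simp: rough_almost_primes_def Omega_eq_0_iff prime_nat_iff)

text \<open>The bound \<open>nth_prime 1 = 2\<close> excludes no prime, and
  \<open>Omega 1 = 0\<close> rules out \<open>n = 1\<close>. These are the sets that the theorem
  counts.\<close>

lemma rough_almost_primes_1:
  "rough_almost_primes s (Suc k) 1 y
     = {n. 1 < n \<and> real n \<le> y \<and> Omega n = Suc k \<and> (s \<longrightarrow> squarefree n)}"
proof -
  have "nth_prime 1 \<le> q" if "prime q" for q
    using prime_obtain_index[OF that] by (metis nth_prime_le_iff order_refl)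
  moreover have "0 < n \<and> Omega n = Suc k \<longleftrightarrow> 1 < n \<and> Omega n = Suc k" for n
    by (cases "n = 1") auto
  ultimately show ?thesis
    unfolding rough_almost_primes_def by blast
qed

text \<open>The primes above \<open>nth_prime i\<close> are those from the next index on, so adding
  \<open>of_bool s\<close> makes the lower bound strict exactly in the square-free case.\<close>

lemma nth_prime_add_of_bool_le_iff:
  assumes "prime q" "1 \<le> i"
  shows "nth_prime (i + of_bool s) \<le> q \<longleftrightarrow> nth_prime i \<le> q \<and> (s \<longrightarrow> q \<noteq> nth_prime i)"
proof -
  obtain j where "1 \<le> j" "q = nth_prime j"
    using prime_obtain_index[OF assms(1)] .
  moreover from this assms(2) have "q = nth_prime i \<longleftrightarrow> j = i"
    using inj_onD[OF inj_on_nth_prime, of j i] by auto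
  ultimately show ?thesis
    using assms(2) by (cases s) (auto simp: nth_prime_le_iff)
qed

text \<open>This closes the recursion: removing the least prime factor lowers \<open>Omega\<close>
  by one, divides the real bound by that prime and moves the index bound to \<open>i\<close>, or to
  \<open>i + 1\<close> in the square-free case.\<close>

lemma prime_times_in_rough_almost_primes_iff:
  assumes "1 \<le> m" "m \<le> i" "0 < n"
  shows "nth_prime i * n \<in> rough_almost_primes s (Suc k) m y
           \<and> (\<forall>q. prime q \<and> q dvd n \<longrightarrow> nth_prime i \<le> q)
         \<longleftrightarrow> n \<in> rough_almost_primes s k (i + of_bool s) (y / real (nth_prime i))"
proof -
  let ?p = "nth_prime i"
  have mi: "nth_prime m \<le> ?p"
    using assms by (simp add: nth_prime_le_iff)
  have dvd: "q dvd ?p * n \<longleftrightarrow> q = ?p \<or> q dvd n" if "prime q" for q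
    using that prime_nth_prime[of i] by (auto simp: prime_dvd_mult_iff primes_dvd_imp_eq)
  have le: "real (?p * n) \<le> y \<longleftrightarrow> real n \<le> y / real ?p"
    using nth_prime_pos[of i] by (simp add: field_simps)
  \<comment> \<open>The condition added by the shift, that \<open>?p\<close> does not divide
    \<open>n\<close>, is what squarefreeness of \<open>?p * n\<close> demands beyond that of
    \<open>n\<close>.\<close>
  have bound: "(\<forall>q. prime q \<and> q dvd n \<longrightarrow> nth_prime (i + of_bool s) \<le> q)
     \<longleftrightarrow> (\<forall>q. prime q \<and> q dvd n \<longrightarrow> ?p \<le> q) \<and> (s \<longrightarrow> \<not> ?p dvd n)"
    using assms nth_prime_add_of_bool_le_iff[of _ i s] prime_nth_prime[of i] by (metis le_trans)
  have low: "(\<forall>q. prime q \<and> q dvd ?p * n \<longrightarrow> nth_prime m \<le> q)"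
    if "\<forall>q. prime q \<and> q dvd n \<longrightarrow> ?p \<le> q"
    using that dvd mi by (metis le_trans)
  show ?thesis
    unfolding rough_almost_primes_def mem_Collect_eq le bound
    using low assms(3) nth_prime_pos[of i] prime_nth_prime[of i]
    by (auto simp: Omega_prime_times squarefree_prime_times_iff)
qed

text \<open>The elements are sorted by the index \<open>i\<close> of their least prime
  factor.\<close>

lemma rough_almost_primes_Suc:
  assumes "1 \<le> m" "0 < y"
  shows "rough_almost_primes s (Suc k) m y
    = (\<Union>i\<in>{m..prime_count (root (Suc k) y)}.
         (*) (nth_prime i) ` rough_almost_primes s k (i + of_bool s) (y / real (nth_prime i)))"
    (is "_ = ?R")
proof (intro equalityI subsetI)
  fix n assume n: "n \<in> rough_almost_primes s (Suc k) m y"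
  define p where "p = (LEAST q. prime q \<and> q dvd n)"
  have n0: "0 < n" and On: "Omega n = Suc k" and ny: "real n \<le> y"
    using n by (auto simp: rough_almost_primes_def)
  then have "\<exists>q. prime q \<and> q dvd n"
    by (intro prime_factor_nat) auto
  then have p: "prime p" "p dvd n"
    unfolding p_def by (metis (mono_tags, lifting) LeastI_ex)+
  have least: "p \<le> q" if "prime q" "q dvd n" for q
    unfolding p_def using that by (intro Least_le) auto
  obtain i where i: "1 \<le> i" "p = nth_prime i"
    using prime_obtain_index[OF p(1)] .
  have "nth_prime m \<le> p"
    using n p by (auto simp: rough_almost_primes_def)
  with i assms have mi: "m \<le> i" by (simp add: nth_prime_le_iff)
  \<comment> \<open>All \<open>k + 1\<close> prime factors of \<open>n\<close> are at least
    \<open>p\<close>; with \<open>n \<le> y\<close> this bounds \<open>i\<close> from above.\<close>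
  have "p ^ Suc k \<le> n"
    using power_Omega_le[of n p] least n0 On by simp
  then have "real p ^ Suc k \<le> y"
    using ny by (metis of_nat_le_iff of_nat_power order_trans)
  then have ub: "i \<le> prime_count (root (Suc k) y)"
    using i assms by (subst le_prime_count_root_iff) auto
  obtain n' where n': "n = p * n'"
    using p(2) by auto
  then have "n' \<in> rough_almost_primes s k (i + of_bool s) (y / real (nth_prime i))"
    using n n0 least i mi assms
    by (intro prime_times_in_rough_almost_primes_iff[THEN iffD1]) auto
  then have "n \<in> (*) (nth_prime i) ` rough_almost_primes s k (i + of_bool s) (y / real (nth_prime i))"
    unfolding n' i(2) by (rule imageI)
  then show "n \<in> ?R"
    using mi ub by (intro UN_I) auto
next
  fix n assume "n \<in> ?R"
  then obtain i n' where "i \<in> {m..prime_count (root (Suc k) y)}" "n = nth_prime i * n'"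
    and *: "n' \<in> rough_almost_primes s k (i + of_bool s) (y / real (nth_prime i))"
    by blast
  moreover from * have "0 < n'" by (simp add: rough_almost_primes_def)
  ultimately show "n \<in> rough_almost_primes s (Suc k) m y"
    using prime_times_in_rough_almost_primes_iff[OF assms(1), of i n' s k y] by simp
qed

text \<open>The union is disjoint because a product determines its least prime factor, and
  multiplication by a fixed prime preserves cardinality.\<close>

lemma card_rough_almost_primes_Suc:
  assumes "1 \<le> m" "0 < y"
  shows "card (rough_almost_primes s (Suc k) m y)
    = (\<Sum>i = m..prime_count (root (Suc k) y).
         card (rough_almost_primes s k (i + of_bool s) (y / real (nth_prime i))))"
proof -
  let ?S = "\<lambda>i. rough_almost_primes s k (i + of_bool s) (y / real (nth_prime i))"
  \<comment> \<open>\<open>nth_prime j\<close> equals \<open>nth_prime i\<close> or divides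
    \<open>a\<close>, whose prime factors are all at least \<open>nth_prime i\<close>. Exchanging
    the roles of \<open>i\<close> and \<open>j\<close> then gives equality.\<close>
  have least: "nth_prime i \<le> nth_prime j"
    if ij: "m \<le> i" "m \<le> j" and a: "a \<in> ?S i" and b: "b \<in> ?S j"
      and eq: "nth_prime i * a = nth_prime j * b" for i j a b
  proof -
    have "0 < a" using a by (simp add: rough_almost_primes_def)
    then have "\<forall>q. prime q \<and> q dvd a \<longrightarrow> nth_prime i \<le> q"
      using prime_times_in_rough_almost_primes_iff[OF assms(1) ij(1)] a by blast
    moreover have "nth_prime j dvd nth_prime i * a"
      unfolding eq by simp
    ultimately show ?thesis
      using prime_nth_prime[of i] prime_nth_prime[of j]
      by (metis order_refl prime_dvd_mult_iff primes_dvd_imp_eq)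
  qed
  have disj: "(*) (nth_prime i) ` ?S i \<inter> (*) (nth_prime j) ` ?S j = {}"
    if ij: "m \<le> i" "m \<le> j" "i \<noteq> j" for i j
  proof (rule ccontr)
    assume "(*) (nth_prime i) ` ?S i \<inter> (*) (nth_prime j) ` ?S j \<noteq> {}"
    then obtain a b where ab: "a \<in> ?S i" "b \<in> ?S j" "nth_prime i * a = nth_prime j * b"
      by auto
    have "nth_prime i = nth_prime j"
      using least[OF ij(1,2) ab] least[OF ij(2,1) ab(2,1) ab(3)[symmetric]] by simp
    with inj_onD[OF inj_on_nth_prime, of i j] ij assms(1) show False by auto
  qed
  have inj: "inj_on ((*) (nth_prime i)) A" for i A
    using nth_prime_pos[of i] by (auto simp: inj_on_def)
  show ?thesis
    unfolding rough_almost_primes_Suc[OF assms]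
    using disj by (subst card_UN_disjoint) (auto simp: finite_rough_almost_primes card_image[OF inj])
qed

text \<open>Each prime \<open>p \<le> y\<close> leaves only the cofactor 1, because
  \<open>1 \<le> y / p\<close>. Hence the indices from \<open>m\<close> to
  \<open>prime_count y\<close> are counted; the subtraction is truncated.\<close>

lemma card_rough_primes:
  assumes "1 \<le> m" "0 < y"
  shows "card (rough_almost_primes s 1 m y) = Suc (prime_count y) - m"
proof -
  have "card (rough_almost_primes s 1 m y) = (\<Sum>i = m..prime_count y. 1)"
    unfolding One_nat_def card_rough_almost_primes_Suc[OF assms] real_root_Suc_0
  proof (intro sum.cong refl)
    fix i assume "i \<in> {m..prime_count y}"
    then have "real (nth_prime i) \<le> y"
      using assms by (subst le_prime_count_iff[symmetric]) auto
    then show "card (rough_almost_primes s 0 (i + of_bool s) (y / real (nth_prime i))) = Suc 0"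
      using nth_prime_pos[of i] by (subst rough_almost_primes_0) auto
  qed
  then show ?thesis by simp
qed

section \<open>Nested sums\<close>

lemma cofactor_Cons: "cofactor x (i # is) = cofactor x is / real (nth_prime i)"
  by (simp add: cofactor_def)

lemma cofactor_pos: "0 < x \<Longrightarrow> 0 < cofactor x is"
  by (induction "is") (simp_all add: cofactor_Cons nth_prime_pos, simp add: cofactor_def)

text \<open>From \<open>p ^ 2 \<le> p ^ (j + 2) \<le> y\<close> follows
  \<open>p \<le> y / p\<close>. This keeps the innermost summand from being negative, so that it
  agrees with a truncated difference.\<close>

lemma le_prime_count_quotient:
  assumes "1 \<le> i" "0 < y" "i \<le> prime_count (root (j + 2) y)"
  shows "i \<le> prime_count (y / real (nth_prime i))"
proof -
  let ?p = "real (nth_prime i)"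
  have p: "1 \<le> ?p" using nth_prime_pos[of i] by simp
  then have "?p * ?p \<le> ?p * ?p ^ (j + 1)"
    by (intro mult_left_mono self_le_power) auto
  also have "\<dots> \<le> y"
    using assms le_prime_count_root_iff[of i y "j + 2"] by simp
  finally show ?thesis
    using p assms by (subst le_prime_count_iff) (auto simp: field_simps)
qed

text \<open>The sums obey the same recursion as the cardinalities. The condition on
  \<open>hd is\<close> is the invariant handed inwards, and the last hypothesis ensures that the
  summand at \<open>j = 0\<close> has an index to read.\<close>

lemma nested_sum_eq_card:
  assumes "0 < x" "is \<noteq> [] \<longrightarrow> 1 \<le> hd is \<and> hd is \<le> prime_count (cofactor x is)"
    "j = 0 \<longrightarrow> is \<noteq> []"
  shows "nested_sum x j is
    = int (card (rough_almost_primes False (Suc j) (if is = [] then 1 else hd is) (cofactor x is)))"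
  using assms
proof (induction j arbitrary: "is")
  case 0
  \<comment> \<open>The invariant makes the natural subtraction
    \<open>Suc (prime_count (cofactor x is)) - hd is\<close> exact, which yields the summand with
    its \<open>+ 1\<close>.\<close>
  then show ?case
    using card_rough_primes[of "hd is" "cofactor x is" False] by (simp add: cofactor_pos)
next
  case (Suc j)
  have low: "1 \<le> (if is = [] then 1 else hd is)"
    using Suc.prems by simp
  show ?case
    unfolding card_rough_almost_primes_Suc[OF low cofactor_pos[OF Suc.prems(1)]] of_nat_sum
      nested_sum.simps
  proof (rule sum.cong)
    fix i assume "i \<in> {if is = [] then 1 else hd is..prime_count (root (Suc (Suc j)) (cofactor x is))}"
    \<comment> \<open>This is the invariant for the extended list \<open>i # is\<close>.\<close>
    then have "1 \<le> i" "i \<le> prime_count (cofactor x (i # is))"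
      using le_prime_count_quotient[of i "cofactor x is" j] low cofactor_pos[OF Suc.prems(1)]
      by (auto simp: cofactor_Cons)
    then show "nested_sum x j (i # is) = int (card (rough_almost_primes False (Suc j)
        (i + of_bool False) (cofactor x is / real (nth_prime i))))"
      using Suc.IH[of "i # is"] Suc.prems(1) by (simp add: cofactor_Cons)
  qed simp
qed

lemma sqfree_nested_sum_eq_card:
  assumes "0 < x" "is \<noteq> [] \<longrightarrow> 1 \<le> hd is \<and> hd is \<le> prime_count (cofactor x is)"
    "j = 0 \<longrightarrow> is \<noteq> []"
  shows "sqfree_nested_sum x j is
    = int (card (rough_almost_primes True (Suc j) (if is = [] then 1 else hd is + 1) (cofactor x is)))"
  using assms
proof (induction j arbitrary: "is")
  case 0
  \<comment> \<open>The lower index is now \<open>hd is + 1\<close>, so the \<open>Suc\<close>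
    cancels and the summand carries no \<open>+ 1\<close>.\<close>
  then show ?case
    using card_rough_primes[of "hd is + 1" "cofactor x is" True] by (simp add: cofactor_pos)
next
  case (Suc j)
  have low: "1 \<le> (if is = [] then 1 else hd is + 1)"
    by simp
  show ?case
    unfolding card_rough_almost_primes_Suc[OF low cofactor_pos[OF Suc.prems(1)]] of_nat_sum
      sqfree_nested_sum.simps
  proof (rule sum.cong)
    fix i assume "i \<in> {if is = [] then 1 else hd is + 1..prime_count (root (Suc (Suc j)) (cofactor x is))}"
    then have "1 \<le> i" "i \<le> prime_count (cofactor x (i # is))"
      using le_prime_count_quotient[of i "cofactor x is" j] low cofactor_pos[OF Suc.prems(1)]
      by (auto simp: cofactor_Cons split: if_splits)
    then show "sqfree_nested_sum x j (i # is) = int (card (rough_almost_primes True (Suc j)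
        (i + of_bool True) (cofactor x is / real (nth_prime i))))"
      using Suc.IH[of "i # is"] Suc.prems(1) by (simp add: cofactor_Cons)
  qed simp
qed

theorem theorem1p1:
  fixes k :: nat and x :: real
  assumes "k \<ge> 2" and "x > 0"
  shows "int (almost_prime_count k x) = nested_sum x (k - 1) []
       \<and> int (sqfree_almost_prime_count k x) = sqfree_nested_sum x (k - 1) []"
proof -
  obtain j where k: "k = Suc (Suc j)"
    using assms(1) by (metis add_2_eq_Suc le_Suc_ex)
  \<comment> \<open>With no index chosen yet, the cofactor is \<open>x\<close> and the index bound
    is 1; \<open>k - 1 = Suc j\<close> is positive, as the empty list requires.\<close>
  show ?thesis
    using nested_sum_eq_card[of x "[]" "Suc j"] sqfree_nested_sum_eq_card[of x "[]" "Suc j"] assms(2)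
    by (simp add: k almost_prime_count_def sqfree_almost_prime_count_def cofactor_def
        rough_almost_primes_1[unfolded One_nat_def] del: nested_sum.simps sqfree_nested_sum.simps)
qed

end
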